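(* Let $f$ be the extended $f$-vector of an Eulerian poset of rank $d$ (in the convention where the dimensions of its elements range from $-1$ to $d$). Then $$\sum_{k=0}^{d-1} (-1)^k\, k \left(\sum_{i=0}^k f_{i,\,i+d-1-k}-f_k-f_{d-1-k}\right) = 0.$$
   Context: An Eulerian poset is a finite graded poset with a least element and a greatest element in which every interval $[x,y]$ with $x<y$ has equally many elements of even rank and of odd rank. Convention used here: an Eulerian poset "of rank $d$" has a dimension function (rank minus one, the rank of the least element being $0$) for which the least element has dimension $-1$ and the greatest element has dimension $d$; for instance, the face lattice of a $d$-dimensional polytope, ordered by inclusion and including the empty face and the polytope itself, is such a poset, with dimension being the usual dimension of faces. For $S\subseteq\{-1,0,\ldots,d\}$, $f_S$ is the number of chains in the poset for which the set of dimensions of the elements of the chain is exactly $S$ (one element for each dimension in $S$). The collection of all $f_S$ is the extended $f$-vector. One writes $f_k$ for $f_{\{k\}}$ and $f_{i,j}$ for $f_{\{i,j\}}$; in particular $f_{i,i}=f_i$. *)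

theory Defs
  imports Main
begin

definition covers :: "'a rel \<Rightarrow> 'a \<Rightarrow> 'a \<Rightarrow> bool" where
  "covers r x y \<longleftrightarrow> (x, y) \<in> r \<and> x \<noteq> y \<and> (\<forall>z. (x, z) \<in> r \<and> (z, y) \<in> r \<longrightarrow> z = x \<or> z = y)"

definition poset_interval :: "'a rel \<Rightarrow> 'a \<Rightarrow> 'a \<Rightarrow> 'a set" where
  "poset_interval r x y = {z. (x, z) \<in> r \<and> (z, y) \<in> r}"

(* The carrier P, the order r and its bounds are explicit. Since every element of P is
   reachable from bot by finitely many covering steps, the rank function is determined
   on P by the last two graded-poset axioms; its values outside P are irrelevant. *)
locale bounded_graded_poset =
  fixes P :: "'a set" and r :: "'a rel" and bot top :: 'a and rank :: "'a \<Rightarrow> nat"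
  assumes finite_carrier: "finite P"
    and partial_order: "partial_order_on P r"
    and bot_in: "bot \<in> P" and bot_least: "\<And>x. x \<in> P \<Longrightarrow> (bot, x) \<in> r"
    and top_in: "top \<in> P" and top_greatest: "\<And>x. x \<in> P \<Longrightarrow> (x, top) \<in> r"
    and rank_bot: "rank bot = 0"
    and rank_covers: "\<And>x y. covers r x y \<Longrightarrow> rank y = Suc (rank x)"

locale eulerian_poset = bounded_graded_poset +
  assumes eulerian: "\<And>x y. (x, y) \<in> r \<Longrightarrow> x \<noteq> y \<Longrightarrow>
    card {z \<in> poset_interval r x y. even (rank z)} =
    card {z \<in> poset_interval r x y. odd (rank z)}"

definition dimension :: "('a \<Rightarrow> nat) \<Rightarrow> 'a \<Rightarrow> int" where
  "dimension rank x = int (rank x) - 1"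

(* In a graded poset the dimension is injective on chains, so a chain with dimension
   set S has exactly one element for each dimension in S. For an order on P, every
   member of Chains r is a subset of P, by the case a = b in its definition. *)
definition extended_f_vector :: "'a rel \<Rightarrow> ('a \<Rightarrow> nat) \<Rightarrow> int set \<Rightarrow> nat" where
  "extended_f_vector r rank S = card {C \<in> Chains r. dimension rank ` C = S}"

end

theory Submission
  imports Defs
begin

text \<open>
  Write \<open>\<epsilon>(x)\<close> for the parity sign of the dimension of \<open>x\<close> and call an element proper if it is
  neither the least nor the greatest one. The numbers \<open>f\<^sub>i\<^sub>,\<^sub>j\<close> with \<open>j - i = d - 1 - k\<close> count
  pairs \<open>x \<le> y\<close> of proper elements with \<open>dim y - dim x = d - 1 - k\<close>. Hence the double sum in the
  theorem is
  \<open>\<Sum> (-1)^(d - 1 - dim y + dim x) * (d - 1 - dim y + dim x)\<close> over all these pairs.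

  The weight is \<open>(-1)^(d - 1) * \<epsilon>(x) * \<epsilon>(y)\<close> times the sum of \<open>d - 1 - dim y\<close>, which depends on
  \<open>y\<close> alone, and \<open>dim x\<close>, which depends on \<open>x\<close> alone. So in each of the two parts one variable can
  be summed out. The Eulerian condition on the interval from the least element to \<open>y\<close> says that
  the signs of the proper \<open>x \<le> y\<close> add up to \<open>1\<close> (lemma \<open>sum_signs_below\<close>); the one on the interval
  from \<open>x\<close> to the greatest element says that the signs of the proper \<open>y \<ge> x\<close> add up to
  \<open>-(-1)^d\<close> (lemma \<open>sum_signs_above\<close>). What remains is
  \<open>\<Sum> (-1)^(d - 1 - dim y) * (d - 1 - dim y)\<close> plus \<open>\<Sum> (-1)^(dim x) * dim x\<close> over the proper
  elements, and grouping by dimension turns these into the subtracted terms with \<open>f\<^sub>d\<^sub>-\<^sub>1\<^sub>-\<^sub>k\<close> and \<open>f\<^sub>k\<close>.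
\<close>

section \<open>Signs and summation over fibres\<close>

text \<open>This is \<open>(-1)^k\<close> for every integer \<open>k\<close>. Truncating to natural exponents would give the wrong
  sign at the dimension \<open>-1\<close> of the least element, which enters the Euler relations.\<close>

definition parity_sign :: "int \<Rightarrow> int" where
  "parity_sign k = (if even k then 1 else - 1)"

lemma minus_one_power_nat:
  assumes "0 \<le> k"
  shows "(- 1) ^ nat k = parity_sign k"
  using assms by (auto simp: parity_sign_def even_nat_iff)

lemma sum_times_card_fibres:
  fixes h :: "'b \<Rightarrow> int"
  assumes "finite S" "finite T" "g ` S \<subseteq> T"
  shows "(\<Sum>t\<in>T. h t * int (card {p \<in> S. g p = t})) = (\<Sum>p\<in>S. h (g p))"
proof -
  have "(\<Sum>t\<in>T. h t * int (card {p \<in> S. g p = t})) = (\<Sum>t\<in>T. \<Sum>p\<in>{p \<in> S. g p = t}. h (g p))"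
    by (rule sum.cong) auto
  also have "\<dots> = (\<Sum>p\<in>S. h (g p))"
    by (rule sum.group[OF assms])
  finally show ?thesis .
qed

section \<open>Chains of length at most two in a graded poset\<close>

context bounded_graded_poset
begin

abbreviation dim :: "'a \<Rightarrow> int" where
  "dim \<equiv> dimension rank"

lemma order_carrier: "(x, y) \<in> r \<Longrightarrow> x \<in> P \<and> y \<in> P"
  using partial_order unfolding partial_order_on_def preorder_on_def by blast

lemma order_refl: "x \<in> P \<Longrightarrow> (x, x) \<in> r"
  using partial_order unfolding partial_order_on_def preorder_on_def refl_on_def by blast

lemma order_trans: "(x, y) \<in> r \<Longrightarrow> (y, z) \<in> r \<Longrightarrow> (x, z) \<in> r"
  using partial_order unfolding partial_order_on_def preorder_on_def by (blast dest: transD)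

lemma order_antisym: "(x, y) \<in> r \<Longrightarrow> (y, x) \<in> r \<Longrightarrow> x = y"
  using partial_order unfolding partial_order_on_def by (blast dest: antisymD)

lemma finite_poset_interval: "finite (poset_interval r x y)"
  using finite_carrier order_carrier
  by (auto simp: poset_interval_def intro: rev_finite_subset)

text \<open>The rank is only prescribed along covering relations; a non-covering pair is split at an
  intermediate element into two pairs that bound smaller intervals.\<close>

lemma rank_strict_mono:
  assumes "(x, y) \<in> r" "x \<noteq> y"
  shows "rank x < rank y"
  using assms
proof (induction "card (poset_interval r x y)" arbitrary: x y rule: less_induct)
  case less
  show ?case
  proof (cases "covers r x y")
    case True
    then show ?thesis using rank_covers by simp
  next
    case False
    then obtain z where z: "(x, z) \<in> r" "(z, y) \<in> r" "z \<noteq> x" "z \<noteq> y"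
      using less.prems unfolding covers_def by blast
    have refl: "(x, x) \<in> r" "(y, y) \<in> r"
      using less.prems(1) by (blast dest: order_carrier intro: order_refl)+
    have "poset_interval r x z \<subseteq> poset_interval r x y" "y \<notin> poset_interval r x z"
      "y \<in> poset_interval r x y"
      unfolding poset_interval_def
      using z refl less.prems by (blast intro: order_trans dest: order_antisym)+
    then have "card (poset_interval r x z) < card (poset_interval r x y)"
      by (intro psubset_card_mono finite_poset_interval) blast
    then have "rank x < rank z" using less.hyps z by blast
    have "poset_interval r z y \<subseteq> poset_interval r x y" "x \<notin> poset_interval r z y"
      "x \<in> poset_interval r x y"
      unfolding poset_interval_def
      using z refl less.prems by (blast intro: order_trans dest: order_antisym)+
    then have "card (poset_interval r z y) < card (poset_interval r x y)"
      by (intro psubset_card_mono finite_poset_interval) blast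
    then have "rank z < rank y" using less.hyps z by blast
    with \<open>rank x < rank z\<close> show ?thesis by simp
  qed
qed

lemma dim_strict_mono: "(x, y) \<in> r \<Longrightarrow> x \<noteq> y \<Longrightarrow> dim x < dim y"
  using rank_strict_mono by (simp add: dimension_def)

lemma dim_mono: "(x, y) \<in> r \<Longrightarrow> dim x \<le> dim y"
  using dim_strict_mono by (cases "x = y") fastforce+

lemma same_dim_eq: "(x, y) \<in> r \<Longrightarrow> dim x = dim y \<Longrightarrow> x = y"
  using dim_strict_mono by fastforce

text \<open>Comparable elements of equal dimension coincide, so a chain with dimensions \<open>i < j\<close> is the
  same as a related pair, and for \<open>i = j\<close> both sides degenerate to single elements. Thus the
  convention \<open>f\<^sub>i\<^sub>,\<^sub>i = f\<^sub>i\<close> needs no separate treatment when pairs are summed.\<close>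

lemma extended_f_vector_pair:
  assumes "i \<le> j"
  shows "extended_f_vector r rank {i, j} = card {(x, y) \<in> r. dim x = i \<and> dim y = j}"
proof -
  let ?pairs = "{(x, y) \<in> r. dim x = i \<and> dim y = j}"
  let ?chains = "{C \<in> Chains r. dim ` C = {i, j}}"
  have "bij_betw (\<lambda>(x, y). {x, y}) ?pairs ?chains"
    unfolding bij_betw_def
  proof
    show "inj_on (\<lambda>(x, y). {x, y}) ?pairs"
    proof (rule inj_onI)
      fix p q
      assume "p \<in> ?pairs" "q \<in> ?pairs" "(\<lambda>(x, y). {x, y}) p = (\<lambda>(x, y). {x, y}) q"
      then show "p = q"
        using same_dim_eq[of "fst p" "snd p"] by (cases p; cases q) (auto simp: doubleton_eq_iff)
    qed
    show "(\<lambda>(x, y). {x, y}) ` ?pairs = ?chains"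
    proof
      show "(\<lambda>(x, y). {x, y}) ` ?pairs \<subseteq> ?chains"
        by (auto simp: Chains_def intro: order_refl dest: order_carrier)
      show "?chains \<subseteq> (\<lambda>(x, y). {x, y}) ` ?pairs"
      proof
        fix C assume C: "C \<in> ?chains"
        then have comparable: "(a, b) \<in> r \<or> (b, a) \<in> r" if "a \<in> C" "b \<in> C" for a b
          using that unfolding Chains_def by blast
        have "i \<in> dim ` C" "j \<in> dim ` C" using C by auto
        then obtain x y where xy: "x \<in> C" "dim x = i" "y \<in> C" "dim y = j"
          by auto
        have "(x, y) \<in> r"
          using comparable[OF \<open>x \<in> C\<close> \<open>y \<in> C\<close>] dim_mono[of y x] same_dim_eq[of y x] xy assms by auto
        moreover have "C = {x, y}"
        proof -
          have "c = x \<or> c = y" if "c \<in> C" for c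
          proof -
            have "dim c = dim x \<or> dim c = dim y" using C that xy by auto
            then show ?thesis using comparable that xy same_dim_eq by metis
          qed
          then show ?thesis using xy by blast
        qed
        ultimately show "C \<in> (\<lambda>(x, y). {x, y}) ` ?pairs" using xy by force
      qed
    qed
  qed
  then show ?thesis
    unfolding extended_f_vector_def by (simp add: bij_betw_same_card)
qed

lemma extended_f_vector_singleton:
  "extended_f_vector r rank {k} = card {x \<in> P. dim x = k}"
proof -
  have "(x, y) \<in> r \<and> dim x = k \<and> dim y = k \<longleftrightarrow> x = y \<and> x \<in> P \<and> dim x = k" for x y
    using order_carrier[of x y] order_refl[of x] same_dim_eq[of x y] by auto
  then have "{(x, y) \<in> r. dim x = k \<and> dim y = k} = (\<lambda>x. (x, x)) ` {x \<in> P. dim x = k}"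
    by auto
  then show ?thesis
    using extended_f_vector_pair[of k k] by (simp add: card_image inj_on_def)
qed

definition proper_part :: "'a set" where
  "proper_part = P - {bot, top}"

lemma finite_proper_part: "finite proper_part"
  using finite_carrier by (simp add: proper_part_def)

lemma proper_part_iff_dim:
  "x \<in> proper_part \<longleftrightarrow> x \<in> P \<and> 0 \<le> dim x \<and> dim x \<le> dim top - 1"
proof
  assume "x \<in> proper_part"
  then show "x \<in> P \<and> 0 \<le> dim x \<and> dim x \<le> dim top - 1"
    using dim_strict_mono[of bot x] dim_strict_mono[of x top] bot_least top_greatest rank_bot
    by (auto simp: proper_part_def dimension_def)
next
  assume "x \<in> P \<and> 0 \<le> dim x \<and> dim x \<le> dim top - 1"
  then show "x \<in> proper_part"
    using rank_bot by (auto simp: proper_part_def dimension_def)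
qed

section \<open>Grouping sums over the proper part by dimension\<close>

lemma sum_f_vector_by_dim:
  fixes h :: "int \<Rightarrow> int"
  shows "(\<Sum>k = 0..dim top - 1. h k * int (extended_f_vector r rank {k}))
    = (\<Sum>x\<in>proper_part. h (dim x))"
proof -
  have "(\<Sum>k = 0..dim top - 1. h k * int (extended_f_vector r rank {k}))
      = (\<Sum>k = 0..dim top - 1. h k * int (card {x \<in> proper_part. dim x = k}))"
  proof (rule sum.cong)
    fix k assume "k \<in> {0..dim top - 1}"
    then have "{x \<in> P. dim x = k} = {x \<in> proper_part. dim x = k}"
      by (auto simp: proper_part_iff_dim)
    then show "h k * int (extended_f_vector r rank {k})
        = h k * int (card {x \<in> proper_part. dim x = k})"
      by (simp add: extended_f_vector_singleton)
  qed simp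
  also have "\<dots> = (\<Sum>x\<in>proper_part. h (dim x))"
    by (rule sum_times_card_fibres) (auto simp: finite_proper_part proper_part_iff_dim)
  finally show ?thesis .
qed

lemma sum_f_vector_by_codim:
  fixes h :: "int \<Rightarrow> int"
  shows "(\<Sum>k = 0..dim top - 1. h k * int (extended_f_vector r rank {dim top - 1 - k}))
    = (\<Sum>x\<in>proper_part. h (dim top - 1 - dim x))"
proof -
  have "(\<Sum>k = 0..dim top - 1. h k * int (extended_f_vector r rank {dim top - 1 - k}))
      = (\<Sum>k = 0..dim top - 1. h (dim top - 1 - k) * int (extended_f_vector r rank {k}))"
    by (rule sum.reindex_bij_witness[where i = "\<lambda>k. dim top - 1 - k" and j = "\<lambda>k. dim top - 1 - k"])
      auto
  then show ?thesis
    using sum_f_vector_by_dim[of "\<lambda>k. h (dim top - 1 - k)"] by simp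
qed

text \<open>A pair of proper elements is classified by \<open>k = d - 1 - (dim y - dim x)\<close> and \<open>i = dim x\<close>.
  Then \<open>dim y = i + d - 1 - k\<close>, and \<open>i \<le> k\<close> is exactly the condition \<open>dim y \<le> d - 1\<close> that keeps
  \<open>y\<close> below the greatest element.\<close>

lemma sum_f_vector_by_dim_difference:
  fixes h :: "int \<Rightarrow> int"
  shows "(\<Sum>k = 0..dim top - 1. h k *
      (\<Sum>i = 0..k. int (extended_f_vector r rank {i, i + dim top - 1 - k})))
    = (\<Sum>(x, y) \<in> r \<inter> proper_part \<times> proper_part. h (dim top - 1 - (dim y - dim x)))"
proof -
  let ?R = "r \<inter> proper_part \<times> proper_part"
  let ?T = "SIGMA k:{0..dim top - 1}. {0..k}"
  let ?g = "\<lambda>(x, y). (dim top - 1 - (dim y - dim x), dim x)"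
  have fibre: "extended_f_vector r rank {i, i + dim top - 1 - k} = card {p \<in> ?R. ?g p = (k, i)}"
    if "k \<in> {0..dim top - 1}" "i \<in> {0..k}" for k i
  proof -
    have "{(x, y) \<in> r. dim x = i \<and> dim y = i + dim top - 1 - k} = {p \<in> ?R. ?g p = (k, i)}"
      using that by (auto simp: proper_part_iff_dim dest: order_carrier)
    moreover have "i \<le> i + dim top - 1 - k" using that by simp
    ultimately show ?thesis by (simp add: extended_f_vector_pair)
  qed
  have "(\<Sum>k = 0..dim top - 1. h k *
      (\<Sum>i = 0..k. int (extended_f_vector r rank {i, i + dim top - 1 - k})))
      = (\<Sum>k = 0..dim top - 1. \<Sum>i = 0..k. h k * int (card {p \<in> ?R. ?g p = (k, i)}))"
    by (simp add: sum_distrib_left fibre)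
  also have "\<dots> = (\<Sum>(k, i)\<in>?T. h k * int (card {p \<in> ?R. ?g p = (k, i)}))"
    by (rule sum.Sigma) auto
  also have "\<dots> = (\<Sum>t\<in>?T. h (fst t) * int (card {p \<in> ?R. ?g p = t}))"
    by (rule sum.cong) auto
  also have "\<dots> = (\<Sum>p\<in>?R. h (fst (?g p)))"
  proof (rule sum_times_card_fibres)
    show "finite ?R" using finite_proper_part by auto
    show "finite ?T" by auto
    show "?g ` ?R \<subseteq> ?T" by (auto simp: proper_part_iff_dim dest: dim_mono)
  qed
  finally show ?thesis by (simp add: case_prod_beta)
qed

end

section \<open>Euler relations in the proper part\<close>

context eulerian_poset
begin

lemma sum_signs_interval:
  assumes "(x, y) \<in> r" "x \<noteq> y"
  shows "(\<Sum>z\<in>poset_interval r x y. parity_sign (dim z)) = 0"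
proof -
  let ?I = "poset_interval r x y"
  have "(\<Sum>z\<in>?I. parity_sign (dim z)) = (\<Sum>z\<in>?I. if even (rank z) then - 1 else 1)"
    by (rule sum.cong) (auto simp: parity_sign_def dimension_def)
  also have "\<dots> = int (card {z \<in> ?I. odd (rank z)}) - int (card {z \<in> ?I. even (rank z)})"
    by (simp add: sum.If_cases finite_poset_interval Int_def)
  also have "\<dots> = 0" using eulerian[OF assms] by simp
  finally show ?thesis .
qed

text \<open>The interval from the least element to \<open>y\<close> consists of the proper elements below \<open>y\<close>, with
  \<open>y\<close> included, and the least element, which contributes the sign \<open>-1\<close>.\<close>

lemma sum_signs_below:
  assumes "y \<in> proper_part"
  shows "(\<Sum>x | x \<in> proper_part \<and> (x, y) \<in> r. parity_sign (dim x)) = 1"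
proof -
  have y: "(bot, y) \<in> r" "bot \<noteq> y" "(y, top) \<in> r" "y \<noteq> top"
    using assms bot_least top_greatest by (auto simp: proper_part_def)
  have "poset_interval r bot y = insert bot {x. x \<in> proper_part \<and> (x, y) \<in> r}"
    using y unfolding poset_interval_def proper_part_def
    by (auto intro: bot_in bot_least order_refl dest: order_carrier order_antisym)
  moreover have "bot \<notin> proper_part" by (simp add: proper_part_def)
  ultimately have "parity_sign (dim bot)
      + (\<Sum>x | x \<in> proper_part \<and> (x, y) \<in> r. parity_sign (dim x)) = 0"
    using sum_signs_interval[OF y(1,2)] finite_proper_part by simp
  then show ?thesis by (simp add: dimension_def rank_bot parity_sign_def)
qed

lemma sum_signs_above:
  assumes "x \<in> proper_part"
  shows "(\<Sum>y | y \<in> proper_part \<and> (x, y) \<in> r. parity_sign (dim y)) = - parity_sign (dim top)"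
proof -
  have x: "(bot, x) \<in> r" "bot \<noteq> x" "(x, top) \<in> r" "x \<noteq> top"
    using assms bot_least top_greatest by (auto simp: proper_part_def)
  have "poset_interval r x top = insert top {y. y \<in> proper_part \<and> (x, y) \<in> r}"
    using x unfolding poset_interval_def proper_part_def
    by (auto intro: top_in top_greatest order_refl dest: order_carrier order_antisym)
  moreover have "top \<notin> proper_part" by (simp add: proper_part_def)
  ultimately have "parity_sign (dim top)
      + (\<Sum>y | y \<in> proper_part \<and> (x, y) \<in> r. parity_sign (dim y)) = 0"
    using sum_signs_interval[OF x(3,4)] finite_proper_part by simp
  then show ?thesis by simp
qed

text \<open>The pair sum decouples here, because \<open>d - 1 - dim y + dim x\<close> is a function of \<open>y\<close> plus a
  function of \<open>x\<close>, and its sign is a product of such functions. The part with \<open>d - 1 - dim y\<close> is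
  summed over \<open>x\<close> first, the part with \<open>dim x\<close> over \<open>y\<close> first; in the second part the coefficient
  \<open>-(-1)^d\<close> cancels against the value of the sum of signs above \<open>x\<close>.\<close>

lemma signed_sum_over_pairs:
  defines "h \<equiv> \<lambda>k. parity_sign k * k"
  shows "(\<Sum>(x, y) \<in> r \<inter> proper_part \<times> proper_part. h (dim top - 1 - (dim y - dim x)))
    = (\<Sum>x\<in>proper_part. h (dim x)) + (\<Sum>y\<in>proper_part. h (dim top - 1 - dim y))"
proof -
  let ?Q = proper_part and ?d = "dim top"
  let ?a = "\<lambda>x. h (dim x)" and ?b = "\<lambda>y. h (?d - 1 - dim y)"
  let ?\<epsilon> = "\<lambda>x. parity_sign (dim x)"
  have split: "h (?d - 1 - (dim y - dim x)) = ?b y * ?\<epsilon> x + - parity_sign ?d * ?a x * ?\<epsilon> y" for x y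
    by (cases "even (dim x)"; cases "even (dim y)"; cases "even ?d")
      (simp_all add: h_def parity_sign_def)
  have pairs_below: "r \<inter> ?Q \<times> ?Q = prod.swap ` (SIGMA y:?Q. {x. x \<in> ?Q \<and> (x, y) \<in> r})"
    by force
  have pairs_above: "r \<inter> ?Q \<times> ?Q = (SIGMA x:?Q. {y. y \<in> ?Q \<and> (x, y) \<in> r})"
    by auto
  have "(\<Sum>(x, y) \<in> r \<inter> ?Q \<times> ?Q. ?b y * ?\<epsilon> x)
      = (\<Sum>y\<in>?Q. \<Sum>x | x \<in> ?Q \<and> (x, y) \<in> r. ?b y * ?\<epsilon> x)"
    unfolding pairs_below
    by (subst sum.reindex)
      (auto simp: sum.Sigma finite_proper_part case_prod_beta intro: inj_on_subset[OF inj_swap])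
  also have "\<dots> = (\<Sum>y\<in>?Q. ?b y)"
    by (simp add: sum_distrib_left[symmetric] sum_signs_below)
  finally have below: "(\<Sum>(x, y) \<in> r \<inter> ?Q \<times> ?Q. ?b y * ?\<epsilon> x) = (\<Sum>y\<in>?Q. ?b y)" .
  have "(\<Sum>(x, y) \<in> r \<inter> ?Q \<times> ?Q. - parity_sign ?d * ?a x * ?\<epsilon> y)
      = (\<Sum>x\<in>?Q. \<Sum>y | y \<in> ?Q \<and> (x, y) \<in> r. - parity_sign ?d * ?a x * ?\<epsilon> y)"
    unfolding pairs_above by (rule sum.Sigma[symmetric]) (auto simp: finite_proper_part)
  also have "\<dots> = (\<Sum>x\<in>?Q. - parity_sign ?d * ?a x * (- parity_sign ?d))"
    by (rule sum.cong) (simp_all only: sum_distrib_left[symmetric] sum_signs_above)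
  also have "\<dots> = (\<Sum>x\<in>?Q. ?a x)"
    by (rule sum.cong) (auto simp: parity_sign_def)
  finally have above: "(\<Sum>(x, y) \<in> r \<inter> ?Q \<times> ?Q. - parity_sign ?d * ?a x * ?\<epsilon> y) = (\<Sum>x\<in>?Q. ?a x)" .
  show ?thesis
    unfolding split using below above by (simp add: case_prod_beta sum_subtractf sum_negf)
qed

end

theorem theorem6:
  fixes P :: "'a set" and r :: "'a rel" and bot top :: 'a
    and rank :: "'a \<Rightarrow> nat" and d :: int and f :: "int set \<Rightarrow> nat"
  assumes "eulerian_poset P r bot top rank"
    and "dimension rank top = d"
    and "f = extended_f_vector r rank"
  shows "(\<Sum>k = 0..d - 1. (- 1) ^ nat k * k *
           ((\<Sum>i = 0..k. int (f {i, i + d - 1 - k})) - int (f {k}) - int (f {d - 1 - k}))) = 0"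
proof -
  interpret eulerian_poset P r bot top rank by fact
  let ?h = "\<lambda>k. parity_sign k * k"
  have "(\<Sum>k = 0..d - 1. (- 1) ^ nat k * k *
           ((\<Sum>i = 0..k. int (f {i, i + d - 1 - k})) - int (f {k}) - int (f {d - 1 - k})))
      = (\<Sum>k = 0..d - 1. ?h k * (\<Sum>i = 0..k. int (f {i, i + d - 1 - k})))
        - (\<Sum>k = 0..d - 1. ?h k * int (f {k})) - (\<Sum>k = 0..d - 1. ?h k * int (f {d - 1 - k}))"
    unfolding sum_subtractf[symmetric]
    by (rule sum.cong) (simp_all add: minus_one_power_nat right_diff_distrib)
  also have "\<dots> = 0"
    using sum_f_vector_by_dim_difference[of ?h] sum_f_vector_by_dim[of ?h]
      sum_f_vector_by_codim[of ?h] signed_sum_over_pairs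
    unfolding assms(3) assms(2)[symmetric] by simp
  finally show ?thesis .
qed

end
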